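(* If a Hausdorff topological space $X$ has a countable Pytkeev network, then its hyperspace $\exp(X)$ has a countable Pytkeev network.
   Context: For a topological space $X$, $\exp(X)$ denotes the space of non-empty compact subsets of $X$ endowed with the Vietoris topology, generated by the base consisting of the sets $$\langle U_1,\dots,U_n\rangle=\{K\in\exp(X):K\subset U_1\cup\dots\cup U_n\text{ and }K\cap U_i\neq\emptyset\text{ for all }i\le n\},$$ where $U_1,\dots,U_n$ run over non-empty open sets in $X$. A subset $A$ of a topological space $X$ accumulates at a point $x\in X$ if each neighborhood of $x$ contains infinitely many points of $A$. A family $\mathcal N$ of subsets of $X$ is a network at $x\in X$ if for any neighborhood $O_x$ of $x$ there is $N\in\mathcal N$ with $x\in N\subset O_x$. It is a Pytkeev network at $x$ if it is a network at $x$ and for each neighborhood $O_x$ of $x$ and each subset $A\subset X$ accumulating at $x$ there is $N\in\mathcal N$ such that $N\subset O_x$ and $N\cap A$ is infinite. It is a Pytkeev network for $X$ if it is a Pytkeev network at each point $x\in X$. *)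

theory Defs
  imports "HOL-Analysis.Analysis"
begin

definition compacts :: "'a topology \<Rightarrow> 'a set set" where
  "compacts X = {K. compactin X K \<and> K \<noteq> {}}"

(* The basic set <U_1, ..., U_n> depends only on the set {U_1, ..., U_n}, so the tuple is
   rendered as a finite set of open sets.  (The empty tuple contributes only the empty set.) *)
definition vietoris_basic :: "'a topology \<Rightarrow> 'a set set \<Rightarrow> 'a set set" where
  "vietoris_basic X \<U> = {K \<in> compacts X. K \<subseteq> \<Union>\<U> \<and> (\<forall>U\<in>\<U>. K \<inter> U \<noteq> {})}"

definition hyperspace :: "'a topology \<Rightarrow> 'a set topology" where
  "hyperspace X = topology_generated_by
     {vietoris_basic X \<U> | \<U>. finite \<U> \<and> (\<forall>U\<in>\<U>. openin X U \<and> U \<noteq> {})}"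

(* Neighborhoods are taken to be open; since every neighborhood contains an open one, this
   does not affect any of the three notions below. *)

definition accumulates_at :: "'a topology \<Rightarrow> 'a set \<Rightarrow> 'a \<Rightarrow> bool" where
  "accumulates_at X A x \<longleftrightarrow> (\<forall>U. openin X U \<and> x \<in> U \<longrightarrow> infinite (U \<inter> A))"

definition network_at :: "'a topology \<Rightarrow> 'a set set \<Rightarrow> 'a \<Rightarrow> bool" where
  "network_at X \<N> x \<longleftrightarrow> (\<forall>U. openin X U \<and> x \<in> U \<longrightarrow> (\<exists>N\<in>\<N>. x \<in> N \<and> N \<subseteq> U))"

definition pytkeev_network_at :: "'a topology \<Rightarrow> 'a set set \<Rightarrow> 'a \<Rightarrow> bool" where
  "pytkeev_network_at X \<N> x \<longleftrightarrow> network_at X \<N> x \<and>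
     (\<forall>U A. openin X U \<and> x \<in> U \<and> A \<subseteq> topspace X \<and> accumulates_at X A x \<longrightarrow>
        (\<exists>N\<in>\<N>. N \<subseteq> U \<and> infinite (N \<inter> A)))"

definition pytkeev_network :: "'a topology \<Rightarrow> 'a set set \<Rightarrow> bool" where
  "pytkeev_network X \<N> \<longleftrightarrow>
     \<N> \<subseteq> Pow (topspace X) \<and> (\<forall>x\<in>topspace X. pytkeev_network_at X \<N> x)"

lemma topspace_hyperspace: "topspace (hyperspace X) = compacts X"
proof -
  have "\<exists>\<U>. finite \<U> \<and> (\<forall>U\<in>\<U>. openin X U \<and> U \<noteq> {}) \<and> K \<in> vietoris_basic X \<U>"
    if "K \<in> compacts X" for K
  proof (intro exI conjI)
    have "K \<subseteq> topspace X" "K \<noteq> {}"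
      using that by (auto simp: compacts_def compactin_def)
    then show "K \<in> vietoris_basic X {topspace X}" "\<forall>U\<in>{topspace X}. openin X U \<and> U \<noteq> {}"
      using that by (auto simp: vietoris_basic_def)
  qed simp
  then show ?thesis
    unfolding hyperspace_def topology_generated_by_topspace
  proof (intro equalityI subsetI)
    fix K assume "K \<in> \<Union>{vietoris_basic X \<U> |\<U>. finite \<U> \<and> (\<forall>U\<in>\<U>. openin X U \<and> U \<noteq> {})}"
    then show "K \<in> compacts X" by (auto simp: vietoris_basic_def)
  qed blast
qed

lemma vietoris_basic_Int:
  assumes "\<forall>U\<in>\<U>. openin X U" "\<forall>V\<in>\<V>. openin X V" "finite \<U>" "finite \<V>"
    and K: "K \<in> vietoris_basic X \<U> \<inter> vietoris_basic X \<V>"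
  shows "\<exists>\<W>. finite \<W> \<and> (\<forall>W\<in>\<W>. openin X W \<and> W \<noteq> {}) \<and> K \<in> vietoris_basic X \<W> \<and>
           vietoris_basic X \<W> \<subseteq> vietoris_basic X \<U> \<inter> vietoris_basic X \<V>"
proof (intro exI conjI)
  define \<W> where "\<W> = (\<lambda>(U, V). U \<inter> V) ` {(U, V) \<in> \<U> \<times> \<V>. K \<inter> (U \<inter> V) \<noteq> {}}"
  show "finite \<W>"
    unfolding \<W>_def using assms(3,4)
    by (intro finite_imageI finite_subset[OF _ finite_cartesian_product[OF assms(3,4)]]) auto
  show "\<forall>W\<in>\<W>. openin X W \<and> W \<noteq> {}"
    using assms(1,2) by (auto simp: \<W>_def)
  have K': "K \<in> compacts X" "K \<subseteq> \<Union>\<U>" "K \<subseteq> \<Union>\<V>"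
    "\<And>U. U \<in> \<U> \<Longrightarrow> K \<inter> U \<noteq> {}" "\<And>V. V \<in> \<V> \<Longrightarrow> K \<inter> V \<noteq> {}"
    using K by (auto simp: vietoris_basic_def)
  have in_W: "U \<inter> V \<in> \<W>" if "U \<in> \<U>" "V \<in> \<V>" "x \<in> K" "x \<in> U" "x \<in> V" for U V x
    unfolding \<W>_def by (rule image_eqI[of _ _ "(U, V)"]) (use that in auto)
  have "K \<subseteq> \<Union>\<W>"
  proof
    fix x assume "x \<in> K"
    moreover from this obtain U V where "U \<in> \<U>" "x \<in> U" "V \<in> \<V>" "x \<in> V"
      using K'(2,3) by blast
    ultimately show "x \<in> \<Union>\<W>" using in_W[of U V x] by blast
  qed
  moreover have "\<forall>W\<in>\<W>. K \<inter> W \<noteq> {}"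
    by (auto simp: \<W>_def)
  ultimately show "K \<in> vietoris_basic X \<W>"
    using K'(1) by (simp add: vietoris_basic_def)
  have 1: "\<exists>W\<in>\<W>. W \<subseteq> U" if U: "U \<in> \<U>" for U
  proof -
    obtain x V where "x \<in> K" "x \<in> U" "V \<in> \<V>" "x \<in> V"
      using K'(4)[OF U] K'(3) by blast
    then show ?thesis using in_W[OF U] by (meson inf_le1)
  qed
  have 2: "\<exists>W\<in>\<W>. W \<subseteq> V" if V: "V \<in> \<V>" for V
  proof -
    obtain x U where "x \<in> K" "x \<in> V" "U \<in> \<U>" "x \<in> U"
      using K'(5)[OF V] K'(2) by blast
    then show ?thesis using in_W[OF _ V] by (meson inf_le2)
  qed
  have 3: "\<Union>\<W> \<subseteq> \<Union>\<U>" "\<Union>\<W> \<subseteq> \<Union>\<V>"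
    by (auto simp: \<W>_def)
  show "vietoris_basic X \<W> \<subseteq> vietoris_basic X \<U> \<inter> vietoris_basic X \<V>"
  proof
    fix L assume "L \<in> vietoris_basic X \<W>"
    then have L: "L \<in> compacts X" "L \<subseteq> \<Union>\<W>" and M: "\<And>W. W \<in> \<W> \<Longrightarrow> L \<inter> W \<noteq> {}"
      by (auto simp: vietoris_basic_def)
    have "L \<inter> U \<noteq> {}" if "U \<in> \<U>" for U
      using 1[OF that] M by blast
    moreover have "L \<inter> V \<noteq> {}" if "V \<in> \<V>" for V
      using 2[OF that] M by blast
    ultimately show "L \<in> vietoris_basic X \<U> \<inter> vietoris_basic X \<V>"
      using L 3 by (auto simp: vietoris_basic_def)
  qed
qed

(* The generating family is a base, not merely a subbase. *)
lemma openin_hyperspace: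
  "openin (hyperspace X) \<O> \<longleftrightarrow> \<O> \<subseteq> compacts X \<and>
     (\<forall>K\<in>\<O>. \<exists>\<U>. finite \<U> \<and> (\<forall>U\<in>\<U>. openin X U \<and> U \<noteq> {}) \<and>
        K \<in> vietoris_basic X \<U> \<and> vietoris_basic X \<U> \<subseteq> \<O>)"
    (is "_ \<longleftrightarrow> _ \<and> ?R \<O>")
proof
  assume op: "openin (hyperspace X) \<O>"
  then have "\<O> \<subseteq> compacts X"
    using openin_subset topspace_hyperspace by metis
  moreover have "generate_topology_on
      {vietoris_basic X \<U> | \<U>. finite \<U> \<and> (\<forall>U\<in>\<U>. openin X U \<and> U \<noteq> {})} \<O>"
    using op by (simp add: hyperspace_def openin_topology_generated_by_iff)
  then have "?R \<O>"
  proof induction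
    case (Int a b)
    show ?case
    proof
      fix K assume K: "K \<in> a \<inter> b"
      obtain \<U> where u: "finite \<U>" "\<forall>U\<in>\<U>. openin X U \<and> U \<noteq> {}"
          "K \<in> vietoris_basic X \<U>" "vietoris_basic X \<U> \<subseteq> a"
        using bspec[OF Int.IH(1), of K] K by auto
      obtain \<V> where v: "finite \<V>" "\<forall>U\<in>\<V>. openin X U \<and> U \<noteq> {}"
          "K \<in> vietoris_basic X \<V>" "vietoris_basic X \<V> \<subseteq> b"
        using bspec[OF Int.IH(2), of K] K by auto
      obtain \<W> where w: "finite \<W>" "\<forall>W\<in>\<W>. openin X W \<and> W \<noteq> {}" "K \<in> vietoris_basic X \<W>"
          "vietoris_basic X \<W> \<subseteq> vietoris_basic X \<U> \<inter> vietoris_basic X \<V>"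
        using vietoris_basic_Int[of \<U> X \<V> K] u v by auto
      have "vietoris_basic X \<W> \<subseteq> a \<inter> b"
        using w(4) u(4) v(4) by auto
      with w(1-3) show "\<exists>\<W>. finite \<W> \<and> (\<forall>U\<in>\<W>. openin X U \<and> U \<noteq> {}) \<and>
          K \<in> vietoris_basic X \<W> \<and> vietoris_basic X \<W> \<subseteq> a \<inter> b"
        by (intro exI[of _ \<W>] conjI)
    qed
  next
    case (UN \<K>)
    show ?case
    proof
      fix K assume "K \<in> \<Union>\<K>"
      then obtain k where k: "k \<in> \<K>" "K \<in> k" by (rule UnionE)
      obtain \<U> where u: "finite \<U>" "\<forall>U\<in>\<U>. openin X U \<and> U \<noteq> {}"
          "K \<in> vietoris_basic X \<U>" "vietoris_basic X \<U> \<subseteq> k"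
        using bspec[OF UN.IH[OF k(1)] k(2)] by auto
      have "vietoris_basic X \<U> \<subseteq> \<Union>\<K>"
        using u(4) Union_upper[OF k(1)] by (rule order_trans)
      with u(1-3) show "\<exists>\<U>. finite \<U> \<and> (\<forall>U\<in>\<U>. openin X U \<and> U \<noteq> {}) \<and>
          K \<in> vietoris_basic X \<U> \<and> vietoris_basic X \<U> \<subseteq> \<Union>\<K>"
        by (intro exI[of _ \<U>] conjI)
    qed
  next
    case (Basis s)
    then obtain \<U> where "s = vietoris_basic X \<U>" "finite \<U>" "\<forall>U\<in>\<U>. openin X U \<and> U \<noteq> {}"
      by auto
    then show ?case by (intro ballI exI[of _ \<U>]) simp
  qed simp
  ultimately show "\<O> \<subseteq> compacts X \<and> ?R \<O>" ..
next
  assume R: "\<O> \<subseteq> compacts X \<and> ?R \<O>"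
  have "\<exists>T. openin (hyperspace X) T \<and> K \<in> T \<and> T \<subseteq> \<O>" if K: "K \<in> \<O>" for K
  proof -
    obtain \<U> where u: "finite \<U>" "\<forall>U\<in>\<U>. openin X U \<and> U \<noteq> {}"
        "K \<in> vietoris_basic X \<U>" "vietoris_basic X \<U> \<subseteq> \<O>"
      using bspec[OF conjunct2[OF R] K] by auto
    have "openin (hyperspace X) (vietoris_basic X \<U>)"
      unfolding hyperspace_def by (rule topology_generated_by_Basis) (use u(1,2) in blast)
    with u(3,4) show ?thesis by auto
  qed
  then show "openin (hyperspace X) \<O>"
    by (subst openin_subopen) simp
qed

end

theory Submission
  imports Defs
begin

text \<open>
  A Pytkeev network \<open>\<N>\<close> does more than it promises for single points. Let \<open>K\<close> be compact and contained
  in an open set \<open>U\<close>, and let points \<open>c i\<close> be indexed so that every open set around \<open>K\<close> contains \<open>c i\<close>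
  for infinitely many \<open>i\<close>. By compactness some point of \<open>K\<close> has the same property, so a single member
  of \<open>\<N>\<close> inside \<open>U\<close> contains \<open>c i\<close> for infinitely many \<open>i\<close> (\<open>pytkeev_network_selection\<close>). The whole
  proof consists in applying this to well chosen points of compact sets.

  Enumerate \<open>\<N>\<close> as \<open>e 0, e 1, \<dots>\<close> and let \<open>stage e n U\<close> be the union of those of the first \<open>n\<close> members
  that lie in \<open>U\<close>. The network of the hyperspace consists of the sets obtained from a basic set
  \<open>\<langle>U\<^sub>1, \<dots>, U\<^sub>k\<rangle>\<close> by replacing each \<open>U\<^sub>i\<close>, and the union of all of them, by its \<open>n\<close>-th stage.
  There are only countably many such sets, since each is determined by finitely many finite sets of
  indices. For fixed \<open>U\<^sub>1, \<dots>, U\<^sub>k\<close> they increase with \<open>n\<close>, and they exhaust the basic set because a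
  compact subset of an open set \<open>U\<close> lies in some stage of \<open>U\<close>. This already gives a network.

  For the Pytkeev property, let a family \<open>\<A>\<close> of compact sets accumulate at \<open>K \<in> \<langle>U\<^sub>1, \<dots>, U\<^sub>k\<rangle>\<close>. Each
  member \<open>L\<close> of \<open>\<A>\<close> in the basic set has a first stage that captures it, and one stage earlier one of
  the \<open>k + 1\<close> defining conditions fails. One reason for failure is shared by a subfamily that still
  accumulates at \<open>K\<close>.
  If the reason is that \<open>L\<close> is not covered, \<open>pytkeev_network_selection\<close> is applied to points of \<open>L\<close> that
  were not covered (\<open>infinitely_many_subset_stage\<close>). If it is that \<open>L\<close> misses the stage of \<open>U\<^sub>i\<close>, then
  some member of \<open>\<N>\<close> inside \<open>U\<^sub>i\<close> meets infinitely many of the sets \<open>L\<close>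
  (\<open>infinitely_many_meet_network_set\<close>). Either way infinitely many \<open>L\<close> are captured by one stage.

  The second case is the delicate one. Points of \<open>L \<inter> U\<^sub>i\<close> chosen at random need not accumulate
  anywhere in \<open>U\<^sub>i\<close>, and without a countable base at \<open>x \<in> K \<inter> U\<^sub>i\<close> there is no evident way of choosing
  them so that they accumulate at \<open>x\<close>. The Hausdorff property provides an open set \<open>W\<close> that contains \<open>K - U\<^sub>i\<close> and is
  disjoint from a neighbourhood of \<open>x\<close>. Arbitrary points of \<open>L - W\<close> then cluster at the compact set
  \<open>K - W \<subseteq> U\<^sub>i\<close>, and this is all that is needed.
\<close>

section \<open>Accumulation and Vietoris neighbourhoods\<close>

lemma accumulates_at_Un:
  assumes "accumulates_at X (A \<union> B) x"
  shows "accumulates_at X A x \<or> accumulates_at X B x"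
proof (rule ccontr)
  assume "\<not> ?thesis"
  then obtain U V where UV: "openin X U" "x \<in> U" "finite (U \<inter> A)" "openin X V" "x \<in> V" "finite (V \<inter> B)"
    unfolding accumulates_at_def by blast
  then have "infinite ((U \<inter> V) \<inter> (A \<union> B))"
    using assms unfolding accumulates_at_def by blast
  moreover have "(U \<inter> V) \<inter> (A \<union> B) \<subseteq> (U \<inter> A) \<union> (V \<inter> B)" by blast
  ultimately show False
    using UV(3,6) by (meson finite_UnI finite_subset)
qed

lemma accumulates_at_finite_UN:
  assumes "finite I" "accumulates_at X (\<Union>i\<in>I. A i) x" "x \<in> topspace X"
  shows "\<exists>i\<in>I. accumulates_at X (A i) x"
  using assms
proof (induction I)
  case empty
  then show ?case
    unfolding accumulates_at_def by fastforce
next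
  case (insert i I)
  then show ?case
    using accumulates_at_Un[of X "A i" "\<Union>i\<in>I. A i" x] by auto
qed

lemma accumulates_at_Int_open:
  assumes "accumulates_at X A x" "openin X V" "x \<in> V"
  shows "accumulates_at X (A \<inter> V) x"
  unfolding accumulates_at_def
proof (intro allI impI)
  fix U assume "openin X U \<and> x \<in> U"
  then have "infinite ((U \<inter> V) \<inter> A)"
    using assms unfolding accumulates_at_def by blast
  then show "infinite (U \<inter> (A \<inter> V))"
    by (simp add: Int_ac)
qed

lemma openin_hyperspaceE:
  assumes "openin (hyperspace X) \<O>" "K \<in> \<O>"
  obtains \<U> where "finite \<U>" "\<And>U. U \<in> \<U> \<Longrightarrow> openin X U"
    "K \<in> vietoris_basic X \<U>" "vietoris_basic X \<U> \<subseteq> \<O>"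
proof -
  from bspec[OF conjunct2[OF iffD1[OF openin_hyperspace assms(1)]] assms(2)]
  obtain \<U> where \<U>: "finite \<U> \<and> (\<forall>U\<in>\<U>. openin X U \<and> U \<noteq> {}) \<and>
      K \<in> vietoris_basic X \<U> \<and> vietoris_basic X \<U> \<subseteq> \<O>"
    by (rule exE)
  show ?thesis
    by (rule that[of \<U>]) (use \<U> in simp_all)
qed

lemma openin_vietoris_basic:
  assumes "finite \<U>" "\<And>U. U \<in> \<U> \<Longrightarrow> openin X U"
  shows "openin (hyperspace X) (vietoris_basic X \<U>)"
proof (cases "{} \<in> \<U>")
  case True
  then have "vietoris_basic X \<U> = {}"
    unfolding vietoris_basic_def by blast
  then show ?thesis by simp
next
  case False
  then have "\<forall>U\<in>\<U>. openin X U \<and> U \<noteq> {}"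
    using assms(2) by blast
  then show ?thesis
    unfolding hyperspace_def
    by (intro topology_generated_by_Basis) (use assms(1) in blast)
qed

text \<open>
  Accumulation in the hyperspace is used below only through this consequence, for suitable choices
  of one or two open sets.
\<close>

lemma accumulates_at_imp_infinite_vietoris_basic:
  assumes "accumulates_at (hyperspace X) \<A> K" "finite \<U>" "\<And>U. U \<in> \<U> \<Longrightarrow> openin X U"
    and "K \<in> vietoris_basic X \<U>"
  shows "infinite (vietoris_basic X \<U> \<inter> \<A>)"
  using assms(1,4) openin_vietoris_basic[OF assms(2,3)] unfolding accumulates_at_def by simp

lemma pytkeev_network_point:
  assumes "pytkeev_network X \<N>" "openin X U" "x \<in> U"
  obtains N where "N \<in> \<N>" "x \<in> N" "N \<subseteq> U"
proof -
  have "network_at X \<N> x"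
    using assms openin_subset[OF assms(2)]
    unfolding pytkeev_network_def pytkeev_network_at_def by auto
  then show ?thesis
    using assms(2,3) that unfolding network_at_def by meson
qed

section \<open>Selections that cluster at a compact set\<close>

text \<open>
  If every point of \<open>K\<close> had a neighbourhood containing \<open>c i\<close> for only finitely many \<open>i\<close>, finitely many of
  these neighbourhoods would form an open set around \<open>K\<close> contradicting the hypothesis. So the points
  cluster at some \<open>x \<in> K\<close>. Either one value in \<open>U\<close> is taken infinitely often, and any network member
  around this value works, or the values in \<open>U\<close> form a set that accumulates at \<open>x\<close>. Indexing the points,
  instead of taking a set of them, makes the conclusion count indices; in the applications these are
  compact sets, and distinct ones may share their chosen point.
\<close>

lemma pytkeev_network_selection:
  assumes net: "pytkeev_network X \<N>"
    and K: "compactin X K" "K \<subseteq> U" and U: "openin X U"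
    and inf: "\<And>V. openin X V \<Longrightarrow> K \<subseteq> V \<Longrightarrow> infinite {i \<in> I. c i \<in> V}"
  shows "\<exists>N\<in>\<N>. N \<subseteq> U \<and> infinite {i \<in> I. c i \<in> N}"
proof -
  have "\<exists>x\<in>K. \<forall>V. openin X V \<and> x \<in> V \<longrightarrow> infinite {i \<in> I. c i \<in> V}"
  proof (rule ccontr)
    assume no: "\<not> ?thesis"
    define \<V> where "\<V> = {V. openin X V \<and> finite {i \<in> I. c i \<in> V}}"
    have "K \<subseteq> \<Union>\<V>"
      using no unfolding \<V>_def by blast
    then obtain \<F> where F: "finite \<F>" "\<F> \<subseteq> \<V>" "K \<subseteq> \<Union>\<F>"
      using compactinD[OF K(1), of \<V>] unfolding \<V>_def by blast
    have "openin X (\<Union>\<F>)"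
      using F(2) unfolding \<V>_def by blast
    then have "infinite {i \<in> I. c i \<in> \<Union>\<F>}"
      using F(3) by (rule inf)
    moreover have "{i \<in> I. c i \<in> \<Union>\<F>} = (\<Union>V\<in>\<F>. {i \<in> I. c i \<in> V})"
      by blast
    moreover have "finite (\<Union>V\<in>\<F>. {i \<in> I. c i \<in> V})"
      using F(1,2) unfolding \<V>_def by blast
    ultimately show False by simp
  qed
  then obtain x where x: "x \<in> K" "\<And>V. openin X V \<Longrightarrow> x \<in> V \<Longrightarrow> infinite {i \<in> I. c i \<in> V}"
    by blast
  show ?thesis
  proof (cases "\<exists>y\<in>U. infinite {i \<in> I. c i = y}")
    case True
    then obtain y where y: "y \<in> U" "infinite {i \<in> I. c i = y}" by blast
    obtain N where N: "N \<in> \<N>" "y \<in> N" "N \<subseteq> U"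
      using pytkeev_network_point[OF net U y(1)] .
    then have "{i \<in> I. c i = y} \<subseteq> {i \<in> I. c i \<in> N}" by blast
    from infinite_super[OF this y(2)] N show ?thesis by blast
  next
    case False
    define A where "A = c ` I \<inter> U"
    have "accumulates_at X A x"
      unfolding accumulates_at_def
    proof (intro allI impI notI)
      fix V assume V: "openin X V \<and> x \<in> V" and fin: "finite (V \<inter> A)"
      have "infinite {i \<in> I. c i \<in> V \<inter> U}"
        using V U x(1) K(2) by (intro x(2)) auto
      moreover have "{i \<in> I. c i \<in> V \<inter> U} = (\<Union>y\<in>V \<inter> A. {i \<in> I. c i = y})"
        unfolding A_def by auto
      moreover have "finite (\<Union>y\<in>V \<inter> A. {i \<in> I. c i = y})"
        using fin False unfolding A_def by auto
      ultimately show False by simp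
    qed
    moreover have "A \<subseteq> topspace X" "x \<in> U" "x \<in> topspace X"
      using openin_subset[OF U] x(1) K(2) unfolding A_def by auto
    ultimately obtain N where N: "N \<in> \<N>" "N \<subseteq> U" "infinite (N \<inter> A)"
      using net U unfolding pytkeev_network_def pytkeev_network_at_def by meson
    have "N \<inter> A \<subseteq> c ` {i \<in> I. c i \<in> N}"
      unfolding A_def by blast
    then have "infinite {i \<in> I. c i \<in> N}"
      using N(3) finite_surj by blast
    then show ?thesis
      using N by blast
  qed
qed

section \<open>Finite stages of the network inside an open set\<close>

definition stage :: "(nat \<Rightarrow> 'a set) \<Rightarrow> nat \<Rightarrow> 'a set \<Rightarrow> 'a set" where
  "stage e n U = \<Union>(e ` {i. i < n \<and> e i \<subseteq> U})"

lemma stage_subset: "stage e n U \<subseteq> U"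
  unfolding stage_def by blast

lemma stage_0 [simp]: "stage e 0 U = {}"
  unfolding stage_def by simp

lemma stage_mono: "m \<le> n \<Longrightarrow> U \<subseteq> V \<Longrightarrow> stage e m U \<subseteq> stage e n V"
  unfolding stage_def by (intro Union_mono image_mono) auto

lemma subset_stage: "i < n \<Longrightarrow> e i \<subseteq> U \<Longrightarrow> e i \<subseteq> stage e n U"
  unfolding stage_def by blast

text \<open>
  Points of \<open>K\<close> escaping the successive stages would return infinitely often to one \<open>e j \<subseteq> U\<close>, which is
  contained in all stages after the \<open>j\<close>-th.
\<close>

lemma compact_subset_stage:
  assumes net: "pytkeev_network X \<N>" and e: "\<N> \<subseteq> range e"
    and K: "compactin X K" "K \<subseteq> U" and U: "openin X U"
  shows "\<exists>n. K \<subseteq> stage e n U"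
proof (rule ccontr)
  assume "\<not> ?thesis"
  then have "\<forall>n. \<exists>y. y \<in> K - stage e n U" by blast
  then obtain c where c: "\<And>n. c n \<in> K - stage e n U" by metis
  have "{n \<in> UNIV. c n \<in> V} = UNIV" if "K \<subseteq> V" for V
    using c that by blast
  then have "\<exists>N\<in>\<N>. N \<subseteq> U \<and> infinite {n \<in> UNIV. c n \<in> N}"
    by (intro pytkeev_network_selection[OF net K U]) simp
  then obtain j where j: "e j \<subseteq> U" "infinite {n. c n \<in> e j}"
    using e by auto
  have "{n. c n \<in> e j} \<subseteq> {..j}"
  proof
    fix n assume "n \<in> {n. c n \<in> e j}"
    then have "\<not> j < n"
      using c[of n] subset_stage[of j n e U] j(1) by blast
    then show "n \<in> {..j}" by simp
  qed
  from infinite_super[OF this j(2)] show False by simp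
qed

text \<open>
  Each \<open>L \<subseteq> U\<close> in the family lies in a first stage, and one stage earlier some point of \<open>L\<close> was left out.
  These points cluster at \<open>K\<close>, so some \<open>e j \<subseteq> U\<close> contains infinitely many of them. For the sets \<open>L\<close>
  concerned, the stage that left the point out cannot come after the \<open>j\<close>-th.
\<close>

lemma infinitely_many_subset_stage:
  assumes net: "pytkeev_network X \<N>" and e: "\<N> \<subseteq> range e"
    and \<A>: "\<A> \<subseteq> compacts X"
    and acc: "accumulates_at (hyperspace X) \<A> K"
    and K: "K \<in> compacts X" "K \<subseteq> U" and U: "openin X U"
  shows "\<exists>n. infinite {L \<in> \<A>. L \<subseteq> stage e n U}"
proof -
  define I where "I = {L \<in> \<A>. L \<subseteq> U}"
  define m where "m L = (LEAST n. L \<subseteq> stage e n U)" for L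
  have m: "L \<subseteq> stage e (m L) U" if "L \<in> I" for L
  proof -
    have "\<exists>n. L \<subseteq> stage e n U"
      using that \<A> unfolding I_def compacts_def
      by (intro compact_subset_stage[OF net e _ _ U]) auto
    then show ?thesis unfolding m_def by (rule LeastI_ex)
  qed
  have "\<exists>y. y \<in> L - stage e (m L - 1) U" if "L \<in> I" for L
  proof -
    have "L \<noteq> {}"
      using that \<A> unfolding I_def compacts_def by blast
    with m[OF that] have "m L \<noteq> 0" by (metis stage_0 subset_empty)
    then have "\<not> L \<subseteq> stage e (m L - 1) U"
      using not_less_Least[of "m L - 1" "\<lambda>n. L \<subseteq> stage e n U"] unfolding m_def by simp
    then show ?thesis by blast
  qed
  then obtain c where c: "\<And>L. L \<in> I \<Longrightarrow> c L \<in> L - stage e (m L - 1) U" by metis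
  have "\<exists>N\<in>\<N>. N \<subseteq> U \<and> infinite {L \<in> I. c L \<in> N}"
  proof (rule pytkeev_network_selection[OF net _ K(2) U])
    show "compactin X K" using K unfolding compacts_def by blast
    fix V assume V: "openin X V" "K \<subseteq> V"
    have "infinite (vietoris_basic X {U \<inter> V} \<inter> \<A>)"
      by (rule accumulates_at_imp_infinite_vietoris_basic[OF acc])
        (use U V K in \<open>auto simp: vietoris_basic_def compacts_def\<close>)
    moreover have "vietoris_basic X {U \<inter> V} \<inter> \<A> \<subseteq> {L \<in> I. c L \<in> V}"
      using c unfolding vietoris_basic_def I_def by auto
    ultimately show "infinite {L \<in> I. c L \<in> V}"
      by (rule infinite_super[rotated])
  qed
  then obtain j where j: "e j \<subseteq> U" "infinite {L \<in> I. c L \<in> e j}"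
    using e by auto
  have "{L \<in> I. c L \<in> e j} \<subseteq> {L \<in> \<A>. L \<subseteq> stage e (Suc j) U}"
  proof safe
    fix L assume L: "L \<in> I" "c L \<in> e j"
    then have "\<not> j < m L - 1"
      using c[OF L(1)] subset_stage[of j "m L - 1" e U] j(1) by blast
    then have "m L \<le> Suc j" by simp
    then have "L \<subseteq> stage e (Suc j) U"
      using m[OF L(1)] stage_mono[of "m L" "Suc j" U U e] by blast
    then show "\<And>x. x \<in> L \<Longrightarrow> x \<in> stage e (Suc j) U" by blast
    show "L \<in> \<A>" using L(1) unfolding I_def by blast
  qed
  from infinite_super[OF this j(2)] show ?thesis by blast
qed

section \<open>Meeting an open set\<close>

text \<open>
  Only a compact part of \<open>K\<close> inside \<open>U\<close> can be used for a selection. Separating a point \<open>x \<in> K \<inter> U\<close> from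
  the compact set \<open>K - U\<close> by disjoint open sets \<open>V \<ni> x\<close> and \<open>W \<supseteq> K - U\<close> yields the compact part \<open>K - W\<close>.
  A member of the family near \<open>K\<close> meets \<open>V\<close>, hence has points outside \<open>W\<close>, and all these points are
  near \<open>K - W\<close>.
\<close>

lemma infinitely_many_meet_network_set:
  assumes haus: "Hausdorff_space X" and net: "pytkeev_network X \<N>"
    and acc: "accumulates_at (hyperspace X) \<A> K"
    and K: "K \<in> compacts X" and U: "openin X U" "K \<inter> U \<noteq> {}"
  shows "\<exists>N\<in>\<N>. N \<subseteq> U \<and> infinite {L \<in> \<A>. L \<inter> N \<noteq> {}}"
proof -
  have cK: "compactin X K" using K unfolding compacts_def by simp
  obtain x where x: "x \<in> K" "x \<in> U" using U(2) by auto
  have compact_diff: "compactin X (K - V)" if "openin X V" for V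
  proof -
    have "compactin X ((topspace X - V) \<inter> K)"
      using that cK by (intro closed_Int_compactin) auto
    moreover have "(topspace X - V) \<inter> K = K - V"
      using compactin_subset_topspace[OF cK] by blast
    ultimately show ?thesis by simp
  qed
  have "compactin X {x}" 
    using x(2) openin_subset[OF U(1)] by auto
  then obtain V W where VW: "openin X V" "openin X W" "x \<in> V" "K - U \<subseteq> W" "V \<inter> W = {}"
    using Hausdorff_space_compact_separation[OF haus _ compact_diff[OF U(1)], of "{x}"] x(2)
    by (auto simp: disjnt_def)
  define I where "I = {L \<in> \<A>. L - W \<noteq> {}}"
  have "\<forall>L\<in>I. \<exists>y. y \<in> L - W" unfolding I_def by blast
  then obtain c where c: "\<And>L. L \<in> I \<Longrightarrow> c L \<in> L - W" by metis
  have "\<exists>N\<in>\<N>. N \<subseteq> U \<and> infinite {L \<in> I. c L \<in> N}"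
  proof (rule pytkeev_network_selection[OF net compact_diff[OF VW(2)] _ U(1)])
    show "K - W \<subseteq> U" using VW(4) by blast
    fix G assume G: "openin X G" "K - W \<subseteq> G"
    \<comment> \<open>The second open set lies in the first, so these are the compact sets inside \<open>G \<union> W\<close> that meet \<open>V\<close>.\<close>
    have "infinite (vietoris_basic X {G \<union> W, V \<inter> (G \<union> W)} \<inter> \<A>)"
      by (rule accumulates_at_imp_infinite_vietoris_basic[OF acc])
        (use G VW(1-3) x(1) K in \<open>auto simp: vietoris_basic_def\<close>)
    moreover have "vietoris_basic X {G \<union> W, V \<inter> (G \<union> W)} \<inter> \<A> \<subseteq> {L \<in> I. c L \<in> G}"
    proof
      fix L assume "L \<in> vietoris_basic X {G \<union> W, V \<inter> (G \<union> W)} \<inter> \<A>"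
      then have L: "L \<in> \<A>" "L \<subseteq> G \<union> W" "L \<inter> V \<noteq> {}"
        unfolding vietoris_basic_def by auto
      then have "L \<in> I" using VW(5) unfolding I_def by blast
      with c[OF this] L(2) show "L \<in> {L \<in> I. c L \<in> G}" by blast
    qed
    ultimately show "infinite {L \<in> I. c L \<in> G}"
      by (rule infinite_super[rotated])
  qed
  then obtain N where N: "N \<in> \<N>" "N \<subseteq> U" "infinite {L \<in> I. c L \<in> N}" by blast
  have "{L \<in> I. c L \<in> N} \<subseteq> {L \<in> \<A>. L \<inter> N \<noteq> {}}"
    using c unfolding I_def by blast
  from infinite_super[OF this N(3)] N(1,2) show ?thesis by blast
qed

section \<open>The network of the hyperspace\<close>

text \<open>
  The stage of the union is included because it may contain network members that lie in no single
  element of \<open>\<U>\<close>: the covering condition may use them, while the meeting conditions may not.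
\<close>

definition vietoris_stage :: "'a topology \<Rightarrow> (nat \<Rightarrow> 'a set) \<Rightarrow> nat \<Rightarrow> 'a set set \<Rightarrow> 'a set set" where
  "vietoris_stage X e n \<U> = vietoris_basic X (stage e n ` insert (\<Union>\<U>) \<U>)"

lemma mem_vietoris_stage_iff:
  "L \<in> vietoris_stage X e n \<U> \<longleftrightarrow>
     L \<in> compacts X \<and> L \<subseteq> stage e n (\<Union>\<U>) \<and> (\<forall>U\<in>\<U>. L \<inter> stage e n U \<noteq> {})"
proof -
  have "stage e n U \<subseteq> stage e n (\<Union>\<U>)" if "U \<in> \<U>" for U
    using that by (intro stage_mono) auto
  then have "\<Union>(stage e n ` insert (\<Union>\<U>) \<U>) = stage e n (\<Union>\<U>)"
    by auto
  then have "L \<in> vietoris_stage X e n \<U> \<longleftrightarrow>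
     L \<in> compacts X \<and> L \<subseteq> stage e n (\<Union>\<U>) \<and> (\<forall>V\<in>stage e n ` insert (\<Union>\<U>) \<U>. L \<inter> V \<noteq> {})"
    unfolding vietoris_stage_def vietoris_basic_def by (simp only: mem_Collect_eq)
  moreover have "L \<inter> stage e n (\<Union>\<U>) \<noteq> {}" if "L \<in> compacts X" "L \<subseteq> stage e n (\<Union>\<U>)"
    using that by (simp add: compacts_def Int_absorb2)
  ultimately show ?thesis
    unfolding image_insert ball_simps by argo
qed

lemma vietoris_stage_subset: "vietoris_stage X e n \<U> \<subseteq> vietoris_basic X \<U>"
proof
  fix L assume "L \<in> vietoris_stage X e n \<U>"
  then have L: "L \<in> compacts X" "L \<subseteq> stage e n (\<Union>\<U>)" "\<And>U. U \<in> \<U> \<Longrightarrow> L \<inter> stage e n U \<noteq> {}"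
    unfolding mem_vietoris_stage_iff by auto
  have "L \<inter> U \<noteq> {}" if "U \<in> \<U>" for U
    using L(3)[OF that] stage_subset[of e n U] by auto
  then show "L \<in> vietoris_basic X \<U>"
    using L(1,2) stage_subset[of e n "\<Union>\<U>"] unfolding vietoris_basic_def by auto
qed

lemma vietoris_stage_mono:
  assumes "m \<le> n"
  shows "vietoris_stage X e m \<U> \<subseteq> vietoris_stage X e n \<U>"
proof
  fix L assume "L \<in> vietoris_stage X e m \<U>"
  then have L: "L \<in> compacts X" "L \<subseteq> stage e m (\<Union>\<U>)" "\<And>U. U \<in> \<U> \<Longrightarrow> L \<inter> stage e m U \<noteq> {}"
    unfolding mem_vietoris_stage_iff by auto
  have mono: "stage e m U \<subseteq> stage e n U" for U
    using assms by (intro stage_mono) auto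
  have "L \<inter> stage e n U \<noteq> {}" if "U \<in> \<U>" for U
    using L(3)[OF that] mono[of U] by auto
  then show "L \<in> vietoris_stage X e n \<U>"
    using L(1,2) mono[of "\<Union>\<U>"] unfolding mem_vietoris_stage_iff by auto
qed

lemma vietoris_stages_exhaust:
  assumes net: "pytkeev_network X \<N>" and e: "\<N> \<subseteq> range e"
    and \<U>: "finite \<U>" "\<And>U. U \<in> \<U> \<Longrightarrow> openin X U"
    and L: "L \<in> vietoris_basic X \<U>"
  shows "\<exists>n. L \<in> vietoris_stage X e n \<U>"
proof -
  have L': "compactin X L" "L \<in> compacts X" "L \<subseteq> \<Union>\<U>" "\<And>U. U \<in> \<U> \<Longrightarrow> L \<inter> U \<noteq> {}"
    using L unfolding vietoris_basic_def compacts_def by auto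
  have "openin X (\<Union>\<U>)" using \<U>(2) by blast
  then obtain n0 where "L \<subseteq> stage e n0 (\<Union>\<U>)"
    using compact_subset_stage[OF net e L'(1,3)] by blast
  then have "L \<subseteq> stage e n (\<Union>\<U>)" if "n0 \<le> n" for n
    using stage_mono[OF that order_refl] by (rule order_trans)
  then have 1: "\<forall>\<^sub>F n in sequentially. L \<subseteq> stage e n (\<Union>\<U>)"
    by (rule eventually_sequentiallyI)
  have "\<forall>\<^sub>F n in sequentially. L \<inter> stage e n U \<noteq> {}" if U: "U \<in> \<U>" for U
  proof -
    obtain x where x: "x \<in> L" "x \<in> U" using L'(4)[OF U] by auto
    obtain N where "N \<in> \<N>" "x \<in> N" "N \<subseteq> U"
      using pytkeev_network_point[OF net \<U>(2)[OF U] x(2)] .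
    then obtain j where j: "x \<in> e j" "e j \<subseteq> U" using e by blast
    then have "L \<inter> stage e n U \<noteq> {}" if "Suc j \<le> n" for n
      using subset_stage[of j n e U] that x(1) by auto
    then show ?thesis by (rule eventually_sequentiallyI)
  qed
  then have "\<forall>\<^sub>F n in sequentially. \<forall>U\<in>\<U>. L \<inter> stage e n U \<noteq> {}"
    using \<U>(1) by (simp add: eventually_ball_finite)
  with 1 have "\<forall>\<^sub>F n in sequentially. L \<in> vietoris_stage X e n \<U>"
    by eventually_elim (simp add: mem_vietoris_stage_iff L'(2))
  then show ?thesis using eventually_happens' trivial_limit_sequentially by blast
qed

text \<open>
  The members of \<open>\<A>\<close> in the basic set are sorted by a condition that fails for them just before the
  first stage that captures them. There are finitely many conditions, so one class still accumulates
  at \<open>K\<close>. If the \<open>n\<close>-th stage satisfies the condition of this class for infinitely many of its members,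
  then each of these is captured by the stage \<open>n + 1\<close>.
\<close>

lemma infinite_Int_vietoris_stage:
  assumes haus: "Hausdorff_space X" and net: "pytkeev_network X \<N>" and e: "\<N> \<subseteq> range e"
    and \<U>: "finite \<U>" "\<And>U. U \<in> \<U> \<Longrightarrow> openin X U"
    and K: "K \<in> vietoris_basic X \<U>"
    and acc: "accumulates_at (hyperspace X) \<A> K"
  shows "\<exists>n. infinite (vietoris_stage X e n \<U> \<inter> \<A>)"
proof -
  define \<B> where "\<B> = \<A> \<inter> vietoris_basic X \<U>"
  have acc\<B>: "accumulates_at (hyperspace X) \<B> K"
    unfolding \<B>_def using acc openin_vietoris_basic[OF \<U>] K by (rule accumulates_at_Int_open)
  define m where "m L = (LEAST n. L \<in> vietoris_stage X e n \<U>)" for L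
  have m: "L \<in> vietoris_stage X e (m L) \<U>" if "L \<in> \<B>" for L
    using vietoris_stages_exhaust[OF net e \<U>, of L] that unfolding m_def \<B>_def
    by (auto intro: LeastI_ex)
  have m': "L \<in> vietoris_stage X e (Suc n) \<U>" if "L \<in> \<B>" "\<not> n < m L - 1" for L n
  proof -
    have "m L \<le> Suc n" using that(2) by simp
    from subsetD[OF vietoris_stage_mono[OF this] m[OF that(1)]] show ?thesis .
  qed
  have pred: "L \<notin> vietoris_stage X e (m L - 1) \<U>" if "L \<in> \<B>" for L
  proof -
    have "L \<noteq> {}" using m[OF that] unfolding mem_vietoris_stage_iff compacts_def by simp
    then have "m L \<noteq> 0"
      using m[OF that] unfolding mem_vietoris_stage_iff by (intro notI) simp
    then show ?thesis
      using not_less_Least[of "m L - 1" "\<lambda>n. L \<in> vietoris_stage X e n \<U>"] unfolding m_def by simp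
  qed
  define \<B>0 where "\<B>0 = {L \<in> \<B>. \<not> L \<subseteq> stage e (m L - 1) (\<Union>\<U>)}"
  define \<C> where "\<C> U = {L \<in> \<B>. L \<inter> stage e (m L - 1) U = {}}" for U
  have \<B>_sub: "\<B> \<subseteq> compacts X" unfolding \<B>_def vietoris_basic_def by blast
  have K': "K \<in> compacts X" "K \<subseteq> \<Union>\<U>" "\<And>U. U \<in> \<U> \<Longrightarrow> K \<inter> U \<noteq> {}"
    using K unfolding vietoris_basic_def by auto
  have "\<B> = \<B>0 \<union> (\<Union>U\<in>\<U>. \<C> U)"
  proof (rule set_eqI)
    fix L
    have "\<not> L \<subseteq> stage e (m L - 1) (\<Union>\<U>) \<or> (\<exists>U\<in>\<U>. L \<inter> stage e (m L - 1) U = {})" if "L \<in> \<B>"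
      using pred[OF that] subsetD[OF \<B>_sub that] unfolding mem_vietoris_stage_iff by meson
    then show "L \<in> \<B> \<longleftrightarrow> L \<in> \<B>0 \<union> (\<Union>U\<in>\<U>. \<C> U)"
      unfolding \<B>0_def \<C>_def by auto
  qed
  with acc\<B> have "accumulates_at (hyperspace X) \<B>0 K \<or>
      accumulates_at (hyperspace X) (\<Union>U\<in>\<U>. \<C> U) K"
    using accumulates_at_Un[of "hyperspace X" \<B>0 "\<Union>U\<in>\<U>. \<C> U" K] by simp
  then consider "accumulates_at (hyperspace X) \<B>0 K"
    | U where "U \<in> \<U>" "accumulates_at (hyperspace X) (\<C> U) K"
    using accumulates_at_finite_UN[OF \<U>(1), of "hyperspace X" \<C> K] K'(1)
    unfolding topspace_hyperspace by auto
  then show ?thesis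
  proof cases
    case 1
    have "\<B>0 \<subseteq> compacts X" "openin X (\<Union>\<U>)"
      using \<B>_sub \<U>(2) unfolding \<B>0_def by auto
    then obtain n where n: "infinite {L \<in> \<B>0. L \<subseteq> stage e n (\<Union>\<U>)}"
      using infinitely_many_subset_stage[OF net e _ 1 K'(1,2)] by blast
    have "{L \<in> \<B>0. L \<subseteq> stage e n (\<Union>\<U>)} \<subseteq> vietoris_stage X e (Suc n) \<U> \<inter> \<A>"
    proof
      fix L assume "L \<in> {L \<in> \<B>0. L \<subseteq> stage e n (\<Union>\<U>)}"
      then have L: "L \<in> \<B>" "\<not> L \<subseteq> stage e (m L - 1) (\<Union>\<U>)" "L \<subseteq> stage e n (\<Union>\<U>)"
        unfolding \<B>0_def by auto
      then have "\<not> n < m L - 1"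
        using stage_mono[OF less_imp_le order_refl, of n "m L - 1" e "\<Union>\<U>"]
        by (meson order_trans)
      with m'[OF L(1)] L(1) show "L \<in> vietoris_stage X e (Suc n) \<U> \<inter> \<A>"
        unfolding \<B>_def by blast
    qed
    from infinite_super[OF this n] show ?thesis by blast
  next
    case 2
    obtain N where "N \<in> \<N>" "N \<subseteq> U" "infinite {L \<in> \<C> U. L \<inter> N \<noteq> {}}"
      using infinitely_many_meet_network_set[OF haus net 2(2) K'(1) \<U>(2)[OF 2(1)] K'(3)[OF 2(1)]]
      by auto
    then obtain j where j: "e j \<subseteq> U" "infinite {L \<in> \<C> U. L \<inter> e j \<noteq> {}}"
      using e by auto
    have "{L \<in> \<C> U. L \<inter> e j \<noteq> {}} \<subseteq> vietoris_stage X e (Suc j) \<U> \<inter> \<A>"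
    proof
      fix L assume "L \<in> {L \<in> \<C> U. L \<inter> e j \<noteq> {}}"
      then have L: "L \<in> \<B>" "L \<inter> stage e (m L - 1) U = {}" "L \<inter> e j \<noteq> {}"
        unfolding \<C>_def by auto
      then have "\<not> j < m L - 1"
        using subset_stage[of j "m L - 1" e U] j(1) by blast
      with m'[OF L(1)] L(1) show "L \<in> vietoris_stage X e (Suc j) \<U> \<inter> \<A>"
        unfolding \<B>_def by blast
    qed
    from infinite_super[OF this j(2)] show ?thesis by blast
  qed
qed

text \<open>
  Although \<open>\<U>\<close> ranges over possibly uncountably many families, a stage depends only on which of the
  first \<open>n\<close> indices are admitted for each member of \<open>\<U>\<close> and for the union.
\<close>

lemma countable_vietoris_stages:
  "countable {vietoris_stage X e n \<U> | n \<U>. finite \<U>}"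
proof (rule countable_subset)
  let ?F = "{\<J>. finite \<J> \<and> \<J> \<subseteq> {J :: nat set. finite J}}"
  have "countable {J :: nat set. finite J}"
    using countable_Collect_finite by blast
  then show "countable ((\<lambda>\<J>. vietoris_basic X ((\<lambda>J. \<Union>(e ` J)) ` \<J>)) ` ?F)"
    by (intro countable_image countable_Collect_finite_subset)
  show "{vietoris_stage X e n \<U> | n \<U>. finite \<U>} \<subseteq>
      (\<lambda>\<J>. vietoris_basic X ((\<lambda>J. \<Union>(e ` J)) ` \<J>)) ` ?F"
  proof clarify
    fix n and \<U> :: "'a set set" assume fin: "finite \<U>"
    let ?\<J> = "(\<lambda>U. {i. i < n \<and> e i \<subseteq> U}) ` insert (\<Union>\<U>) \<U>"
    have "vietoris_stage X e n \<U> = vietoris_basic X ((\<lambda>J. \<Union>(e ` J)) ` ?\<J>)"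
      unfolding vietoris_stage_def image_image stage_def ..
    moreover have "?\<J> \<in> ?F" using fin by auto
    ultimately show "vietoris_stage X e n \<U> \<in>
        (\<lambda>\<J>. vietoris_basic X ((\<lambda>J. \<Union>(e ` J)) ` \<J>)) ` ?F"
      by (rule image_eqI)
  qed
qed

theorem theorem3p7:
  fixes X :: "'a topology"
  assumes "Hausdorff_space X"
    and "\<exists>\<N>. countable \<N> \<and> pytkeev_network X \<N>"
  shows "\<exists>\<M>. countable \<M> \<and> pytkeev_network (hyperspace X) \<M>"
proof -
  obtain \<N> where \<N>: "countable \<N>" and net: "pytkeev_network X \<N>"
    using assms(2) by blast
  define e where "e = from_nat_into \<N>"
  have e: "\<N> \<subseteq> range e"
    unfolding e_def using \<N> by (rule subset_range_from_nat_into)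
  define \<M> where "\<M> = {vietoris_stage X e n \<U> | n \<U>. finite \<U>}"
  have in_\<M>: "vietoris_stage X e n \<U> \<in> \<M>" if "finite \<U>" for n \<U>
    using that unfolding \<M>_def by auto
  have "pytkeev_network_at (hyperspace X) \<M> K" for K
    unfolding pytkeev_network_at_def network_at_def
  proof (intro conjI allI impI)
    fix \<O> assume *: "openin (hyperspace X) \<O> \<and> K \<in> \<O>"
    obtain \<U> where \<U>: "finite \<U>" "\<And>U. U \<in> \<U> \<Longrightarrow> openin X U"
        "K \<in> vietoris_basic X \<U>" "vietoris_basic X \<U> \<subseteq> \<O>"
      by (rule openin_hyperspaceE[OF conjunct1[OF *] conjunct2[OF *]]) (rule that)
    obtain n where "K \<in> vietoris_stage X e n \<U>"
      using vietoris_stages_exhaust[OF net e \<U>(1-3)] by auto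
    with in_\<M>[OF \<U>(1)] order_trans[OF vietoris_stage_subset \<U>(4)]
    show "\<exists>N\<in>\<M>. K \<in> N \<and> N \<subseteq> \<O>"
      by (intro bexI[of _ "vietoris_stage X e n \<U>"] conjI)
  next
    fix \<O> \<A>
    assume *: "openin (hyperspace X) \<O> \<and> K \<in> \<O> \<and> \<A> \<subseteq> topspace (hyperspace X) \<and>
      accumulates_at (hyperspace X) \<A> K"
    obtain \<U> where \<U>: "finite \<U>" "\<And>U. U \<in> \<U> \<Longrightarrow> openin X U"
        "K \<in> vietoris_basic X \<U>" "vietoris_basic X \<U> \<subseteq> \<O>"
      by (rule openin_hyperspaceE[OF conjunct1[OF *] conjunct1[OF conjunct2[OF *]]]) (rule that)
    obtain n where "infinite (vietoris_stage X e n \<U> \<inter> \<A>)"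
      using infinite_Int_vietoris_stage[OF assms(1) net e \<U>(1-3), of \<A>] * by auto
    with in_\<M>[OF \<U>(1)] order_trans[OF vietoris_stage_subset \<U>(4)]
    show "\<exists>N\<in>\<M>. N \<subseteq> \<O> \<and> infinite (N \<inter> \<A>)"
      by (intro bexI[of _ "vietoris_stage X e n \<U>"] conjI)
  qed
  moreover have "\<M> \<subseteq> Pow (topspace (hyperspace X))"
    unfolding \<M>_def topspace_hyperspace vietoris_stage_def vietoris_basic_def by blast
  moreover have "countable \<M>"
    unfolding \<M>_def by (rule countable_vietoris_stages)
  ultimately show ?thesis
    unfolding pytkeev_network_def by blast
qed

end
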